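(* Let $I\subset\mathbb{R}$ be an open interval, let $a,b\in I$ with $a<b$, and let $f:I\to\mathbb{R}$ be a twice differentiable function. Let $\gamma,\Gamma$ be real numbers such that $\gamma\le f''(t)\le\Gamma$ for all $t\in[a,b]$. Then $$\left|\frac{b-a}{6}\left[f(a)+4f\left(\frac{a+b}{2}\right)+f(b)\right]-\int_a^b f(t)\,dt\right|\le\frac{\Gamma-\gamma}{162}(b-a)^3.$$
   Context: No continuity of $f''$ is assumed. *)

theory Defs
  imports "HOL-Analysis.Analysis"
begin

end

(* Put m = (a + b) / 2, h = (b - a) / 2, let F be a primitive of f and
     Phi t = (t - 2 h / 3) (f (m + t) + f (m - t)) - (F (m + t) - F (m - t)).
   The Simpson error is Phi h - Phi 0, and Phi' t = (t - 2 h / 3) g t with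
   g t = f' (m + t) - f' (m - t), where g 0 = 0 and 2 gamma <= g' <= 2 Gamma.  On [0, h / 3] use
   g t >= 2 gamma t.  On [h / 3, h] the weight t - 2 h / 3 is odd about the midpoint and
   g t - 2 Gamma t is nonincreasing, so replacing it by its value at 2 h / 3 only increases the
   integral of the product, and that constant contributes nothing.  The other inequality follows
   by passing to -f. *)
theory Submission
  imports Defs
begin

text \<open>This takes the place of integrating an inequality between derivatives:
  \<open>g - f\<close> is nondecreasing. The derivatives need not be integrable, so it also applies
  to bounds on \<open>f''\<close>.\<close>

lemma has_real_derivative_increment_le:
  fixes f g f' g' :: "real \<Rightarrow> real"
  assumes "a \<le> b" and "continuous_on {a..b} f" and "continuous_on {a..b} g"
    and "\<And>t. a < t \<Longrightarrow> t < b \<Longrightarrow> (f has_real_derivative f' t) (at t)"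
    and "\<And>t. a < t \<Longrightarrow> t < b \<Longrightarrow> (g has_real_derivative g' t) (at t)"
    and "\<And>t. a < t \<Longrightarrow> t < b \<Longrightarrow> f' t \<le> g' t"
  shows "f b - f a \<le> g b - g a"
proof -
  have "g a - f a \<le> g b - f b"
  proof (rule DERIV_nonneg_imp_increasing_open[where f = "\<lambda>t. g t - f t"])
    fix t assume t: "a < t" "t < b"
    have "((\<lambda>t. g t - f t) has_real_derivative g' t - f' t) (at t)"
      by (intro DERIV_diff assms(4,5) t)
    moreover have "0 \<le> g' t - f' t" using assms(6)[OF t] by simp
    ultimately show "\<exists>y. ((\<lambda>t. g t - f t) has_real_derivative y) (at t) \<and> 0 \<le> y" by blast
  qed (use assms in \<open>auto intro: continuous_on_diff\<close>)
  then show ?thesis by simp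
qed

lemma has_real_derivative_reflections:
  fixes f :: "real \<Rightarrow> real"
  shows "(f has_real_derivative D) (at (m + t)) \<Longrightarrow> ((\<lambda>t. f (m + t)) has_real_derivative D) (at t)"
    and "(f has_real_derivative D) (at (m - t)) \<Longrightarrow> ((\<lambda>t. f (m - t)) has_real_derivative - D) (at t)"
proof -
  show "((\<lambda>t. f (m + t)) has_real_derivative D) (at t)" if "(f has_real_derivative D) (at (m + t))"
    using DERIV_chain2[where g = "\<lambda>t. m + t", OF that DERIV_add[OF DERIV_const DERIV_ident]] by simp
  show "((\<lambda>t. f (m - t)) has_real_derivative - D) (at t)" if "(f has_real_derivative D) (at (m - t))"
    using DERIV_chain2[where g = "\<lambda>t. m - t", OF that DERIV_diff[OF DERIV_const DERIV_ident]] by simp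
qed

text \<open>One side of the estimate on \<open>{m-h..m+h}\<close>. \<open>F\<close> is
  differentiated only within the interval, so that an integral from the left endpoint qualifies as
  \<open>F\<close>.\<close>

lemma simpson_error_upper:
  fixes F f f' f'' :: "real \<Rightarrow> real" and m h \<gamma> \<Gamma> :: real
  assumes h: "0 < h"
    and F: "\<And>t. t \<in> {m-h..m+h} \<Longrightarrow> (F has_real_derivative f t) (at t within {m-h..m+h})"
    and f: "\<And>t. t \<in> {m-h..m+h} \<Longrightarrow> (f has_real_derivative f' t) (at t)"
    and f': "\<And>t. t \<in> {m-h..m+h} \<Longrightarrow> (f' has_real_derivative f'' t) (at t)"
    and bounds: "\<And>t. t \<in> {m-h..m+h} \<Longrightarrow> \<gamma> \<le> f'' t \<and> f'' t \<le> \<Gamma>"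
  shows "h / 3 * (f (m - h) + 4 * f m + f (m + h)) - (F (m + h) - F (m - h))
           \<le> 4 / 81 * (\<Gamma> - \<gamma>) * h ^ 3"
proof -
  define g where "g t = f' (m + t) - f' (m - t)" for t
  \<comment> \<open>The shift \<open>2 * h / 3\<close> produces the Simpson weights: the first
    factor is \<open>h / 3\<close> at \<open>t = h\<close> and \<open>- 2 * h / 3\<close> at
    \<open>t = 0\<close>, where \<open>f m\<close> occurs twice.\<close>
  define \<Phi> where "\<Phi> t = (t - 2 * h / 3) * (f (m + t) + f (m - t)) - (F (m + t) - F (m - t))" for t
  have Fopen: "(F has_real_derivative f t) (at t)" if "m - h < t" "t < m + h" for t
    using F[of t] that at_within_Icc_at[of "m - h" t "m + h"] by simp
  have contF: "continuous_on {m-h..m+h} F" by (rule DERIV_continuous_on[OF F])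
  have contf: "continuous_on {m-h..m+h} f"
    by (rule DERIV_continuous_on[OF DERIV_subset[OF f]]) auto
  have cont\<Phi>: "continuous_on {0..h} \<Phi>"
    unfolding \<Phi>_def
    by (intro continuous_intros continuous_on_compose2[OF contF] continuous_on_compose2[OF contf]) auto
  \<comment> \<open>Differentiating the linear factor gives \<open>f (m + t) + f (m - t)\<close>,
    which cancels against the derivative of the \<open>F\<close> terms.\<close>
  have der\<Phi>: "(\<Phi> has_real_derivative (t - 2 * h / 3) * g t) (at t)" if t: "0 < t" "t < h" for t
  proof -
    have "((\<lambda>t. f (m + t)) has_real_derivative f' (m + t)) (at t)"
      "((\<lambda>t. F (m + t)) has_real_derivative f (m + t)) (at t)"
      "((\<lambda>t. f (m - t)) has_real_derivative - f' (m - t)) (at t)"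
      "((\<lambda>t. F (m - t)) has_real_derivative - f (m - t)) (at t)"
      using f Fopen t by (auto intro: has_real_derivative_reflections)
    then show ?thesis
      unfolding \<Phi>_def g_def by (auto intro!: derivative_eq_intros simp: field_simps)
  qed
  have derg: "(g has_real_derivative f'' (m + t) + f'' (m - t)) (at t)" if t: "0 \<le> t" "t \<le> h" for t
  proof -
    have "((\<lambda>t. f' (m + t)) has_real_derivative f'' (m + t)) (at t)"
      "((\<lambda>t. f' (m - t)) has_real_derivative - f'' (m - t)) (at t)"
      using f' t by (auto intro: has_real_derivative_reflections)
    then show ?thesis
      unfolding g_def by (auto intro!: derivative_eq_intros)
  qed
  have g_lipschitz: "2 * \<gamma> * (t - s) \<le> g t - g s \<and> g t - g s \<le> 2 * \<Gamma> * (t - s)"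
    if st: "0 \<le> s" "s \<le> t" "t \<le> h" for s t
  proof -
    have contg: "continuous_on {s..t} g"
      by (rule DERIV_continuous_on[OF DERIV_subset[OF derg]]) (use st in auto)
    have lin: "((\<lambda>x. c * x) has_real_derivative c) (at x)" for c x :: real
      by (auto intro!: derivative_eq_intros)
    have bd: "2 * \<gamma> \<le> f'' (m + x) + f'' (m - x)" "f'' (m + x) + f'' (m - x) \<le> 2 * \<Gamma>"
      if "s < x" "x < t" for x
      using bounds[of "m + x"] bounds[of "m - x"] that st by auto
    have "2 * \<gamma> * t - 2 * \<gamma> * s \<le> g t - g s"
      by (rule has_real_derivative_increment_le[OF st(2) _ contg lin derg])
        (use st bd in \<open>auto intro!: continuous_intros\<close>)
    moreover have "g t - g s \<le> 2 * \<Gamma> * t - 2 * \<Gamma> * s"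
      by (rule has_real_derivative_increment_le[OF st(2) contg _ derg lin])
        (use st bd in \<open>auto intro!: continuous_intros\<close>)
    ultimately show ?thesis by (simp add: algebra_simps)
  qed
  \<comment> \<open>The weight is negative here, so the lower bound on \<open>g\<close> bounds the
    product from above. The cubic is a primitive of \<open>(t - 2 * h / 3) * t\<close>; the
    right-hand side equals \<open>- 4 / 81 * \<gamma> * h ^ 3\<close>.\<close>
  have left: "\<Phi> (h / 3) - \<Phi> 0
      \<le> 2 * \<gamma> * ((h / 3) ^ 3 / 3 - h * (h / 3)\<^sup>2 / 3) - 2 * \<gamma> * (0 ^ 3 / 3 - h * 0\<^sup>2 / 3)"
  proof (rule has_real_derivative_increment_le[where f = \<Phi>
        and g = "\<lambda>t. 2 * \<gamma> * (t ^ 3 / 3 - h * t\<^sup>2 / 3)", OF _ _ _ der\<Phi>])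
    fix t assume t: "0 < t" "t < h / 3"
    show "((\<lambda>t. 2 * \<gamma> * (t ^ 3 / 3 - h * t\<^sup>2 / 3)) has_real_derivative
        (t - 2 * h / 3) * (2 * \<gamma> * t)) (at t)"
      by (auto intro!: derivative_eq_intros simp: algebra_simps power2_eq_square)
    show "(t - 2 * h / 3) * g t \<le> (t - 2 * h / 3) * (2 * \<gamma> * t)"
      using g_lipschitz[of 0 t] t h by (intro mult_left_mono_neg) (auto simp: g_def)
  qed (use h in \<open>auto intro!: continuous_intros intro: continuous_on_subset[OF cont\<Phi>]\<close>)
  \<comment> \<open>\<open>C\<close> is the value of \<open>g t - 2 * \<Gamma> * t\<close> at the
    zero of the weight. Its term in \<open>P\<close> takes equal values at \<open>h / 3\<close> and
    \<open>h\<close>, so \<open>P h - P (h / 3)\<close> is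
    \<open>4 / 81 * \<Gamma> * h ^ 3\<close>.\<close>
  define C where "C = g (2 * h / 3) - 2 * \<Gamma> * (2 * h / 3)"
  define P where "P t = 2 * \<Gamma> * (t ^ 3 / 3 - h * t\<^sup>2 / 3) + C * (t - 2 * h / 3)\<^sup>2 / 2" for t
  have right: "\<Phi> h - \<Phi> (h / 3) \<le> P h - P (h / 3)"
  proof (rule has_real_derivative_increment_le[where f = \<Phi> and g = P, OF _ _ _ der\<Phi>])
    fix t assume t: "h / 3 < t" "t < h"
    show "(P has_real_derivative (t - 2 * h / 3) * (2 * \<Gamma> * t + C)) (at t)"
      unfolding P_def
      by (auto intro!: derivative_eq_intros simp: field_simps power2_eq_square)
    show "(t - 2 * h / 3) * g t \<le> (t - 2 * h / 3) * (2 * \<Gamma> * t + C)"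
    \<comment> \<open>The factor \<open>g t - 2 * \<Gamma> * t - C\<close> is nonnegative left of
      \<open>2 * h / 3\<close> and nonpositive right of it, opposite in sign to the weight.\<close>
    proof (cases "t \<le> 2 * h / 3")
      case True
      then show ?thesis
        using g_lipschitz[of t "2 * h / 3"] t h
        by (intro mult_left_mono_neg) (auto simp: C_def algebra_simps)
    next
      case False
      then show ?thesis
        using g_lipschitz[of "2 * h / 3" t] t h
        by (intro mult_left_mono) (auto simp: C_def algebra_simps)
    qed
  qed (use h in \<open>auto simp: P_def intro!: continuous_intros intro: continuous_on_subset[OF cont\<Phi>]\<close>)
  have "h / 3 * (f (m - h) + 4 * f m + f (m + h)) - (F (m + h) - F (m - h)) = \<Phi> h - \<Phi> 0"
    by (simp add: \<Phi>_def algebra_simps)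
  also have "\<dots> \<le> 2 * \<gamma> * ((h / 3) ^ 3 / 3 - h * (h / 3)\<^sup>2 / 3) + (P h - P (h / 3))"
    using left right by simp
  also have "\<dots> = 4 / 81 * (\<Gamma> - \<gamma>) * h ^ 3"
    by (simp add: P_def field_simps power2_eq_square power3_eq_cube)
  finally show ?thesis .
qed

theorem theorem4:
  fixes I :: "real set" and a b :: real
    and f f' f'' :: "real \<Rightarrow> real" and \<gamma> \<Gamma> :: real
  assumes "open I" and "is_interval I"
    and "a \<in> I" and "b \<in> I" and "a < b"
    and "\<And>t. t \<in> I \<Longrightarrow> (f has_real_derivative f' t) (at t)"
    and "\<And>t. t \<in> I \<Longrightarrow> (f' has_real_derivative f'' t) (at t)"
    and "\<And>t. t \<in> {a..b} \<Longrightarrow> \<gamma> \<le> f'' t \<and> f'' t \<le> \<Gamma>"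
  shows "\<bar>(b - a) / 6 * (f a + 4 * f ((a + b) / 2) + f b) - integral {a..b} f\<bar>
           \<le> (\<Gamma> - \<gamma>) / 162 * (b - a) ^ 3"
proof -
  have sub: "t \<in> I" if "t \<in> {a..b}" for t
    using mem_is_interval_1_I[OF assms(2-4)] that by simp
  have contf: "continuous_on {a..b} f"
    by (rule DERIV_continuous_on[OF DERIV_subset[OF assms(6)[OF sub]]]) auto
  define F where "F x = integral {a..x} f" for x
  define m where "m = (a + b) / 2"
  define h where "h = (b - a) / 2"
  have eqs: "m - h = a" "m + h = b" by (simp_all add: m_def h_def field_simps)
  have h: "0 < h" using assms(5) by (simp add: h_def)
  have F: "(F has_real_derivative f t) (at t within {a..b})" if "t \<in> {a..b}" for t
    unfolding F_def by (rule integral_has_real_derivative[OF contf that])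
  have upper: "h / 3 * (f a + 4 * f m + f b) - (F b - F a) \<le> 4 / 81 * (\<Gamma> - \<gamma>) * h ^ 3"
    using simpson_error_upper[of h m F f f' f'' \<gamma> \<Gamma>, unfolded eqs] h F sub assms(6-8) by blast
  \<comment> \<open>Negation turns the bounds into \<open>- \<Gamma>\<close> and
    \<open>- \<gamma>\<close>, with the same gap, so the one-sided lemma gives the same constant for
    \<open>- f\<close>.\<close>
  have neg: "- \<Gamma> \<le> - f'' t \<and> - f'' t \<le> - \<gamma>" if "t \<in> {a..b}" for t
    using assms(8)[OF that] by simp
  have lower: "h / 3 * (- f a + 4 * - f m + - f b) - (- F b - - F a) \<le> 4 / 81 * (- \<gamma> - - \<Gamma>) * h ^ 3"
    using simpson_error_upper[of h m "\<lambda>t. - F t" "\<lambda>t. - f t" "\<lambda>t. - f' t" "\<lambda>t. - f'' t"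
        "- \<Gamma>" "- \<gamma>", unfolded eqs, OF h DERIV_minus[OF F] DERIV_minus[OF assms(6)[OF sub]]
        DERIV_minus[OF assms(7)[OF sub]] neg] by blast
  have int: "F b - F a = integral {a..b} f" by (simp add: F_def)
  have width: "(b - a) / 6 = h / 3" by (simp add: h_def)
  \<comment> \<open>Since \<open>h\<close> is half of \<open>b - a\<close>, the cube contributes
    1/8, and 4/81 becomes 1/162.\<close>
  have bound: "(\<Gamma> - \<gamma>) / 162 * (b - a) ^ 3 = 4 / 81 * (\<Gamma> - \<gamma>) * h ^ 3"
    by (simp add: h_def power_divide)
  have "- (h / 3 * (f a + 4 * f m + f b) - (F b - F a)) \<le> 4 / 81 * (\<Gamma> - \<gamma>) * h ^ 3"
    using lower by (simp add: algebra_simps)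
  with upper show ?thesis
    unfolding width bound int[symmetric] m_def[symmetric] by (rule abs_leI)
qed

end
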